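(* Let $n$ be a positive integer. (1) The slow Tamari lattice $\operatorname{sTam}_n$ (the set of small fb-tableaux of size $n$) is a sublattice of the extra slow Tamari lattice $\operatorname{esTam}_n$. (2) The poset of binary fb-tableaux of size $n$ is a sublattice of the slow Tamari lattice $\operatorname{sTam}_n$. Moreover, it is isomorphic to the Tamari lattice, i.e. to the poset of bracket vectors of length $n-1$ ordered componentwise.
   Context: Let $n$ be a positive integer. The board of size $n$ is the Ferrers diagram of shape $(n,n,n-1,n-2,\dots,3,2)$ (a single cell $(1,1)$ if $n=1$). Its cells are written $(i,j)$, where $i$ is the row, numbered from the top, and $j$ is the column label, the columns being labelled $n,n-1,\dots,1$ from left to right. So the cells are $(1,j)$ for $1\le j\le n$ and $(i,j)$ for $2\le i\le n$, $i-1\le j\le n$. The root is $(1,n)$ (top-left cell); the border cells are $(i,i-1)$ for $2\le i\le n$ (the rightmost cells of rows $2,\dots,n$). An fb-tableau of size $n$ is a filling in which each cell is either empty or nonempty such that the root and all border cells are nonempty, and every nonempty cell other than the root has a nonempty cell strictly to its left in the same row or strictly above it in the same column. In an fb-tableau, a nonempty cell different from the root is called a left-arrow if there is no nonempty cell strictly to its left in its row, an up-arrow if there is no nonempty cell strictly above it in its column, and a dot otherwise; the root is also a dot. (Each of rows $2,\dots,n$ has exactly one left-arrow, each of columns $1,\dots,n-1$ has exactly one up-arrow.) A cell is free in $T$ if it lies strictly below an up-arrow (same column) and strictly to the right of a left-arrow (same row); a free cell is either empty or contains a dot. $\operatorname{Row}(T)$ is the set of cells lying weakly to the right of a left-arrow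 or of the root in the same row; $\operatorname{Col}(T)$ is the set of cells lying weakly below an up-arrow or the root in the same column. For fb-tableaux $S,T$ of size $n$, write $S\lhd T$ if (1) $\operatorname{Col}(S)\subseteq\operatorname{Col}(T)$; (2) $\operatorname{Row}(T)\subseteq\operatorname{Row}(S)$; (3) for every cell $c$ that is free in both $S$ and $T$, if $c$ contains a dot in $S$ then $c$ contains a dot in $T$. The extra slow Tamari lattice $\operatorname{esTam}_n$ is the set of fb-tableaux of size $n$ ordered by $\lhd$; it is a lattice. An fb-tableau is small if its only dot is the root (equivalently, all its free cells are empty), and binary if it has no free cell. Both sets carry the restriction of $\lhd$. A bracket vector of length $n-1$ is a tuple $(a_1,\dots,a_{n-1})$ of integers with $0\le a_i\le n-i$ and $j+a_{i+j}\le a_i$ for all $1\le j\le a_i$ with $i+j\le n-1$; $(a_i)\le(b_i)$ iff $a_i\le b_i$ for all $i$. This poset is the Tamari lattice. *)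

theory Defs
  imports "HOL-Algebra.Lattice"
begin

text \<open>
  A cell is a pair (row, column label). Rows are numbered downwards, but column labels decrease
  from left to right, so ``strictly to the left'' means a strictly larger second component.
\<close>

type_synonym cell = "nat \<times> nat"

definition board :: "nat \<Rightarrow> cell set" where
  "board n = {(i, j). 1 \<le> i \<and> i \<le> n \<and> 1 \<le> j \<and> j \<le> n \<and> i - 1 \<le> j}"

definition root :: "nat \<Rightarrow> cell" where
  "root n = (1, n)"

definition border :: "nat \<Rightarrow> cell set" where
  "border n = {(i, i - 1) | i. 2 \<le> i \<and> i \<le> n}"

definition strictly_left :: "cell \<Rightarrow> cell \<Rightarrow> bool" where
  "strictly_left d c \<longleftrightarrow> fst d = fst c \<and> snd c < snd d"

definition strictly_above :: "cell \<Rightarrow> cell \<Rightarrow> bool" where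
  "strictly_above d c \<longleftrightarrow> snd d = snd c \<and> fst d < fst c"

text \<open>A filling is represented by its set of nonempty cells.\<close>

definition fb_tableau :: "nat \<Rightarrow> cell set \<Rightarrow> bool" where
  "fb_tableau n T \<longleftrightarrow>
     T \<subseteq> board n \<and> root n \<in> T \<and> border n \<subseteq> T \<and>
     (\<forall>c \<in> T - {root n}. \<exists>d \<in> T. strictly_left d c \<or> strictly_above d c)"

definition left_arrows :: "nat \<Rightarrow> cell set \<Rightarrow> cell set" where
  "left_arrows n T = {c \<in> T - {root n}. \<not> (\<exists>d \<in> T. strictly_left d c)}"

definition up_arrows :: "nat \<Rightarrow> cell set \<Rightarrow> cell set" where
  "up_arrows n T = {c \<in> T - {root n}. \<not> (\<exists>d \<in> T. strictly_above d c)}"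

text \<open>The root is neither a left-arrow nor an up-arrow, so it is one of the dots.\<close>

definition dots :: "nat \<Rightarrow> cell set \<Rightarrow> cell set" where
  "dots n T = T - left_arrows n T - up_arrows n T"

definition free_cells :: "nat \<Rightarrow> cell set \<Rightarrow> cell set" where
  "free_cells n T =
     {c \<in> board n. (\<exists>u \<in> up_arrows n T. strictly_above u c) \<and>
                   (\<exists>l \<in> left_arrows n T. strictly_left l c)}"

definition Row :: "nat \<Rightarrow> cell set \<Rightarrow> cell set" where
  "Row n T =
     {c \<in> board n. \<exists>d \<in> insert (root n) (left_arrows n T). d = c \<or> strictly_left d c}"

definition Col :: "nat \<Rightarrow> cell set \<Rightarrow> cell set" where
  "Col n T =
     {c \<in> board n. \<exists>d \<in> insert (root n) (up_arrows n T). d = c \<or> strictly_above d c}"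

definition fb_le :: "nat \<Rightarrow> cell set \<Rightarrow> cell set \<Rightarrow> bool" where
  "fb_le n S T \<longleftrightarrow>
     Col n S \<subseteq> Col n T \<and>
     Row n T \<subseteq> Row n S \<and>
     (\<forall>c \<in> free_cells n S \<inter> free_cells n T. c \<in> dots n S \<longrightarrow> c \<in> dots n T)"

definition esTam :: "nat \<Rightarrow> cell set gorder" where
  "esTam n = \<lparr>carrier = {T. fb_tableau n T}, eq = (=), le = fb_le n\<rparr>"

definition small :: "nat \<Rightarrow> cell set \<Rightarrow> bool" where
  "small n T \<longleftrightarrow> fb_tableau n T \<and> dots n T = {root n}"

definition sTam :: "nat \<Rightarrow> cell set gorder" where
  "sTam n = (esTam n)\<lparr>carrier := {T. small n T}\<rparr>"

definition binary :: "nat \<Rightarrow> cell set \<Rightarrow> bool" where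
  "binary n T \<longleftrightarrow> fb_tableau n T \<and> free_cells n T = {}"

definition binary_poset :: "nat \<Rightarrow> cell set gorder" where
  "binary_poset n = (esTam n)\<lparr>carrier := {T. binary n T}\<rparr>"

text \<open>
  Tuples of length \<open>n - 1\<close> are functions with domain \<open>{1..n - 1}\<close>, extensional so that equality
  of tuples is equality of functions.
\<close>

definition bracket_vectors :: "nat \<Rightarrow> (nat \<Rightarrow> nat) set" where
  "bracket_vectors n =
     {a \<in> extensional {1..n - 1}.
        (\<forall>i \<in> {1..n - 1}. a i \<le> n - i) \<and>
        (\<forall>i \<in> {1..n - 1}. \<forall>j \<in> {1..a i}. i + j \<le> n - 1 \<longrightarrow> j + a (i + j) \<le> a i)}"

definition Tamari :: "nat \<Rightarrow> (nat \<Rightarrow> nat) gorder" where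
  "Tamari n =
     \<lparr>carrier = bracket_vectors n, eq = (=), le = (\<lambda>a b. \<forall>i \<in> {1..n - 1}. a i \<le> b i)\<rparr>"

text \<open>
  The ambient order is required to be a lattice, since otherwise its join and meet operations
  would be unspecified. Order and equality on \<open>K\<close> are those inherited from \<open>L\<close>.
\<close>

definition sublattice_of :: "'a gorder \<Rightarrow> 'a gorder \<Rightarrow> bool" where
  "sublattice_of K L \<longleftrightarrow>
     lattice L \<and> K = L\<lparr>carrier := carrier K\<rparr> \<and>
     carrier K \<subseteq> carrier L \<and> carrier K \<noteq> {} \<and>
     (\<forall>x \<in> carrier K. \<forall>y \<in> carrier K.
        x \<squnion>\<^bsub>L\<^esub> y \<in> carrier K \<and> x \<sqinter>\<^bsub>L\<^esub> y \<in> carrier K)"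

definition order_isomorphic :: "'a gorder \<Rightarrow> 'b gorder \<Rightarrow> bool" where
  "order_isomorphic A B \<longleftrightarrow> (\<exists>f. bij_betw f (carrier A) (carrier B) \<and> order_emb A B f)"

end

theory Submission
  imports Defs
begin

text \<open>
  An fb-tableau is determined by the column \<open>l\<^sub>i\<close> of the leftmost nonempty cell of each row \<open>i\<close>, the row
  \<open>u\<^sub>j\<close> of the topmost nonempty cell of each column \<open>j\<close> (so \<open>l\<^sub>1 = n\<close> and \<open>u\<^sub>n = 1\<close> at the root), and its
  non-root dots. The constraints on \<open>(l, u)\<close> are \<open>u(l\<^sub>i) < i\<close> for \<open>i \<noteq> 1\<close> and \<open>l(u\<^sub>j) > j\<close> for \<open>j \<noteq> n\<close>; a cell
  is free iff \<open>u\<^sub>j < i\<close> and \<open>j < l\<^sub>i\<close>; and going up in the order decreases both \<open>l\<close> and \<open>u\<close>.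

  Taking minima of \<open>l\<close> and of \<open>u\<close> preserves the first constraint and may violate the second one, which
  is repaired by lowering \<open>u\<^sub>j\<close> to the largest row \<open>r\<close> with \<open>l\<^sub>r > j\<close>; any upper bound is forced to do the
  same. With the union of the two sets of dots this is the join. The meet is dual, except that a cell
  is a dot unless it is free and empty in one of the two tableaux. The repair creates no new free cell, so joins and meets of small or binary tableaux are again of that kind.

  In a binary tableau \<open>l\<^sub>i\<close> is the least \<open>c \<ge> i - 1\<close> with \<open>u\<^sub>c < i\<close>, so \<open>u\<close> determines the tableau, and
  \<open>a\<^sub>k = n - k + 1 - u\<^bsub>n-k\<^esub>\<close> is the corresponding bracket vector.
\<close>

section \<open>Tableaux and their arrows\<close>

text \<open>Column labels decrease from left to right, so the maximum picks out the leftmost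
  cell.\<close>

definition row_end :: "cell set \<Rightarrow> nat \<Rightarrow> nat" where
  "row_end T i = Max {j. (i, j) \<in> T}"

definition col_top :: "cell set \<Rightarrow> nat \<Rightarrow> nat" where
  "col_top T j = (LEAST i. (i, j) \<in> T)"

text \<open>A row end has nothing to its left, so outside row 1 the tableau condition forces a
  nonempty cell above it, whence \<open>u (l i) < i\<close>. Likewise a column top outside column
  \<open>n\<close> needs a nonempty cell to its left.\<close>

definition arrow_shape :: "nat \<Rightarrow> (nat \<Rightarrow> nat) \<Rightarrow> (nat \<Rightarrow> nat) \<Rightarrow> bool" where
  "arrow_shape n l u \<longleftrightarrow>
     l 1 = n \<and> u n = 1 \<and>
     (\<forall>i \<in> {1..n}. (i, l i) \<in> board n) \<and> (\<forall>j \<in> {1..n}. (u j, j) \<in> board n) \<and>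
     (\<forall>i \<in> {1..n}. i \<noteq> 1 \<longrightarrow> u (l i) < i) \<and> (\<forall>j \<in> {1..n}. j \<noteq> n \<longrightarrow> j < l (u j))"

text \<open>The disjunct \<open>i = j + 1\<close> keeps the border cells nonempty even when they are free.\<close>

definition mk_tableau :: "nat \<Rightarrow> (nat \<Rightarrow> nat) \<Rightarrow> (nat \<Rightarrow> nat) \<Rightarrow> cell set \<Rightarrow> cell set" where
  "mk_tableau n l u D =
     {(i, j) \<in> board n. u j \<le> i \<and> j \<le> l i \<and> (i = u j \<or> j = l i \<or> i = j + 1 \<or> (i, j) \<in> D)}"

lemma row_end_eqI: "(i, m) \<in> T \<Longrightarrow> (\<And>j. (i, j) \<in> T \<Longrightarrow> j \<le> m) \<Longrightarrow> row_end T i = m"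
  unfolding row_end_def by (intro Max_eqI) (auto intro: finite_subset[of _ "{..m}"])

lemma col_top_eqI: "(m, j) \<in> T \<Longrightarrow> (\<And>i. (i, j) \<in> T \<Longrightarrow> m \<le> i) \<Longrightarrow> col_top T j = m"
  unfolding col_top_def by (intro Least_equality) auto

lemma arrow_shapeD:
  assumes "arrow_shape n l u"
  shows "l (Suc 0) = n" "u n = Suc 0"
    and "i \<in> {1..n} \<Longrightarrow> i - 1 \<le> l i" "i \<in> {1..n} \<Longrightarrow> 1 \<le> l i" "i \<in> {1..n} \<Longrightarrow> l i \<le> n"
    and "j \<in> {1..n} \<Longrightarrow> u j - 1 \<le> j" "j \<in> {1..n} \<Longrightarrow> 1 \<le> u j" "j \<in> {1..n} \<Longrightarrow> u j \<le> n"
    and "i \<in> {1..n} \<Longrightarrow> i \<noteq> 1 \<Longrightarrow> u (l i) < i"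
    and "j \<in> {1..n} \<Longrightarrow> j \<noteq> n \<Longrightarrow> j < l (u j)"
  using assms unfolding arrow_shape_def board_def by auto

lemma arrow_shapeI:
  assumes "l 1 = n" "u n = 1"
    and "\<And>i. i \<in> {1..n} \<Longrightarrow> (i, l i) \<in> board n" "\<And>j. j \<in> {1..n} \<Longrightarrow> (u j, j) \<in> board n"
    and "\<And>i. i \<in> {1..n} \<Longrightarrow> i \<noteq> 1 \<Longrightarrow> u (l i) < i" "\<And>j. j \<in> {1..n} \<Longrightarrow> j \<noteq> n \<Longrightarrow> j < l (u j)"
  shows "arrow_shape n l u"
  using assms unfolding arrow_shape_def by auto

locale fb_board =
  fixes n :: nat
  assumes n: "1 \<le> n"
begin

text \<open>\<open>D\<close> is arbitrary, since the bounds \<open>u j \<le> i\<close> and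
  \<open>j \<le> l i\<close> discard whatever would move an end. A cell strictly below its column
  top has that top above it; a non-root cell that is its column top has its row end to the left, by
  the last constraint on \<open>(l, u)\<close>.\<close>

lemma mk_tableau:
  assumes "arrow_shape n l u"
  shows "fb_tableau n (mk_tableau n l u D)"
    and "i \<in> {1..n} \<Longrightarrow> row_end (mk_tableau n l u D) i = l i"
    and "j \<in> {1..n} \<Longrightarrow> col_top (mk_tableau n l u D) j = u j"
proof -
  let ?T = "mk_tableau n l u D"
  note A = arrow_shapeD[OF assms]
  have L: "(i, l i) \<in> ?T" if "i \<in> {1..n}" for i
    using that A(9)[OF that] A(3-5)[OF that] n
    by (cases "i = 1") (auto simp: A(1,2) mk_tableau_def board_def)
  have U: "(u j, j) \<in> ?T" if "j \<in> {1..n}" for j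
    using that A(10)[OF that] A(6-8)[OF that] n
    by (cases "j = n") (auto simp: A(1,2) mk_tableau_def board_def)
  show "row_end ?T i = l i" if "i \<in> {1..n}"
    using L[OF that] by (intro row_end_eqI) (auto simp: mk_tableau_def)
  show "col_top ?T j = u j" if "j \<in> {1..n}"
    using U[OF that] by (intro col_top_eqI) (auto simp: mk_tableau_def)
  have "?T \<subseteq> board n" by (auto simp: mk_tableau_def)
  moreover have "root n \<in> ?T" using L[of 1] n by (auto simp: root_def A)
  moreover have "border n \<subseteq> ?T"
  proof (rule subsetI, unfold border_def, clarify)
    fix i assume i: "2 \<le> i" "i \<le> n"
    then have "i - 1 \<in> {1..n}" by auto
    from A(6)[OF this] A(3)[of i] i show "(i, i - 1) \<in> ?T"
      by (auto simp: mk_tableau_def board_def)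
  qed
  moreover have "\<exists>d \<in> ?T. strictly_left d c \<or> strictly_above d c" if "c \<in> ?T - {root n}" for c
  proof -
    obtain i j where c: "c = (i, j)" by (cases c)
    have ij: "i \<in> {1..n}" "j \<in> {1..n}" "u j \<le> i" "(i, j) \<noteq> (1, n)"
      using that by (auto simp: c mk_tableau_def board_def root_def)
    show ?thesis
    proof (cases "u j < i")
      case True
      then show ?thesis using U[of j] ij by (force simp: c strictly_above_def)
    next
      case False
      then have "j < l i" using ij A(10)[of j] by (cases "j = n") (auto simp: A)
      then show ?thesis using L[of i] ij by (force simp: c strictly_left_def)
    qed
  qed
  ultimately show "fb_tableau n ?T" by (auto simp: fb_tableau_def)
qed

text \<open>The root meets row 1 and column \<open>n\<close>, and the border meets every other row
  and column, so no extremum is taken over an empty set.\<close>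

lemma fb_tableau_ends:
  assumes T: "fb_tableau n T"
  shows "i \<in> {1..n} \<Longrightarrow> (i, row_end T i) \<in> T"
    and "(i, j) \<in> T \<Longrightarrow> j \<le> row_end T i"
    and "j \<in> {1..n} \<Longrightarrow> (col_top T j, j) \<in> T"
    and "(i, j) \<in> T \<Longrightarrow> col_top T j \<le> i"
proof -
  have fin: "finite {j. (i, j) \<in> T}" for i
    using T by (auto simp: fb_tableau_def board_def intro: finite_subset[of _ "{..n}"])
  have R: "\<exists>j. (i, j) \<in> T" if "i \<in> {1..n}" for i
  proof (cases "i = 1")
    case True then show ?thesis using T by (auto simp: fb_tableau_def root_def)
  next
    case False
    then have "(i, i - 1) \<in> border n" using that by (auto simp: border_def)
    then show ?thesis using T by (auto simp: fb_tableau_def)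
  qed
  have C: "\<exists>i. (i, j) \<in> T" if "j \<in> {1..n}" for j
  proof (cases "j = n")
    case True then show ?thesis using T by (auto simp: fb_tableau_def root_def)
  next
    case False
    then have "(j + 1, j) \<in> border n" using that by (auto simp: border_def)
    then show ?thesis using T by (auto simp: fb_tableau_def)
  qed
  show "(i, row_end T i) \<in> T" if "i \<in> {1..n}"
    using Max_in[OF fin, of i] R[OF that] unfolding row_end_def by auto
  show "j \<le> row_end T i" if "(i, j) \<in> T"
    using Max_ge[OF fin, of j i] that unfolding row_end_def by auto
  show "(col_top T j, j) \<in> T" if "j \<in> {1..n}"
    using C[OF that] unfolding col_top_def by (rule LeastI_ex)
  show "col_top T j \<le> i" if "(i, j) \<in> T"
    using that unfolding col_top_def by (rule Least_le)
qed

lemma fb_tableau_range: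
  assumes "fb_tableau n T" "(i, j) \<in> T"
  shows "i \<in> {1..n}" "j \<in> {1..n}" "(i, j) \<in> board n"
  using assms by (auto simp: fb_tableau_def board_def)

section \<open>Arrows, free cells and dots in terms of row ends and column tops\<close>

lemma left_arrows_iff:
  assumes T: "fb_tableau n T"
  shows "(i, j) \<in> left_arrows n T \<longleftrightarrow> i \<in> {2..n} \<and> j = row_end T i"
proof -
  have 1: "row_end T 1 = n"
    using T by (intro row_end_eqI) (auto simp: fb_tableau_def root_def board_def)
  show ?thesis
  proof (intro iffI)
    assume "(i, j) \<in> left_arrows n T"
    then have *: "(i, j) \<in> T" "(i, j) \<noteq> (1, n)" "\<And>k. (i, k) \<in> T \<Longrightarrow> k \<le> j"
      by (force simp: left_arrows_def root_def strictly_left_def)+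
    then have "j = row_end T i" using row_end_eqI[of i j T] by simp
    with * 1 fb_tableau_range[OF T *(1)]
    show "i \<in> {2..n} \<and> j = row_end T i" by (cases "i = 1") auto
  next
    assume i: "i \<in> {2..n} \<and> j = row_end T i"
    then have "(i, row_end T i) \<in> T" using fb_tableau_ends[OF T] by auto
    then show "(i, j) \<in> left_arrows n T"
      using fb_tableau_ends(2)[OF T] i
      by (auto simp: left_arrows_def root_def strictly_left_def not_less)
  qed
qed

lemma up_arrows_iff:
  assumes T: "fb_tableau n T"
  shows "(i, j) \<in> up_arrows n T \<longleftrightarrow> j \<in> {1..<n} \<and> i = col_top T j"
proof -
  have 1: "col_top T n = 1"
    using T by (intro col_top_eqI) (auto simp: fb_tableau_def root_def board_def)
  show ?thesis
  proof (intro iffI)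
    assume "(i, j) \<in> up_arrows n T"
    then have *: "(i, j) \<in> T" "(i, j) \<noteq> (1, n)" "\<And>k. (k, j) \<in> T \<Longrightarrow> i \<le> k"
      by (force simp: up_arrows_def root_def strictly_above_def)+
    then have "i = col_top T j" using col_top_eqI[of i j T] by simp
    with * 1 fb_tableau_range[OF T *(1)]
    show "j \<in> {1..<n} \<and> i = col_top T j" by (cases "j = n") auto
  next
    assume j: "j \<in> {1..<n} \<and> i = col_top T j"
    then have "(col_top T j, j) \<in> T" using fb_tableau_ends[OF T] by auto
    then show "(i, j) \<in> up_arrows n T"
      using fb_tableau_ends(4)[OF T] j
      by (auto simp: up_arrows_def root_def strictly_above_def not_less)
  qed
qed

lemma arrow_shape_tableau:
  assumes T: "fb_tableau n T"
  shows "arrow_shape n (row_end T) (col_top T)"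
proof -
  have 1: "row_end T 1 = n"
    using T by (intro row_end_eqI) (auto simp: fb_tableau_def root_def board_def)
  have 2: "col_top T n = 1"
    using T by (intro col_top_eqI) (auto simp: fb_tableau_def root_def board_def)
  note E = fb_tableau_ends[OF T]
  have 3: "col_top T (row_end T i) < i" if i: "i \<in> {1..n}" "i \<noteq> 1" for i
  proof -
    have "(i, row_end T i) \<in> T - {root n}" using E i by (auto simp: root_def)
    then obtain d where "d \<in> T"
      "strictly_left d (i, row_end T i) \<or> strictly_above d (i, row_end T i)"
      using T unfolding fb_tableau_def by blast
    then show ?thesis
      using E(2,4)[of "fst d" "snd d"] by (auto simp: strictly_left_def strictly_above_def)
  qed
  have 4: "j < row_end T (col_top T j)" if j: "j \<in> {1..n}" "j \<noteq> n" for j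
  proof -
    have "(col_top T j, j) \<in> T - {root n}" using E j by (auto simp: root_def)
    then obtain d where "d \<in> T"
      "strictly_left d (col_top T j, j) \<or> strictly_above d (col_top T j, j)"
      using T unfolding fb_tableau_def by blast
    then show ?thesis
      using E(2,4)[of "fst d" "snd d"] by (auto simp: strictly_left_def strictly_above_def)
  qed
  show ?thesis
    using E(1,3)[THEN fb_tableau_range(3)[OF T]] by (intro arrow_shapeI 1 2 3 4)
qed

lemma free_cells_iff:
  assumes T: "fb_tableau n T"
  shows "(i, j) \<in> free_cells n T \<longleftrightarrow> (i, j) \<in> board n \<and> col_top T j < i \<and> j < row_end T i"
proof -
  note A = arrow_shapeD[OF arrow_shape_tableau[OF T]]
  \<comment> \<open>Row 1 has no left-arrow and column \<open>n\<close> no up-arrow. The strict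
    bounds exclude both, as column tops are at least 1 and row ends at most
    \<open>n\<close>.\<close>
  have "i \<noteq> 1" "j \<noteq> n" if "(i, j) \<in> board n" "col_top T j < i" "j < row_end T i"
    using that A(7)[of j] A(5)[of i] by (auto simp: board_def)
  then show ?thesis
    by (auto simp: free_cells_def up_arrows_iff[OF T] left_arrows_iff[OF T]
        strictly_left_def strictly_above_def Bex_def board_def)
qed

text \<open>A nonempty cell other than the root is no arrow exactly when it lies strictly beyond
  both ends, that is, when it is free. The root is a dot without being free.\<close>

lemma dots_iff:
  assumes T: "fb_tableau n T"
  shows "c \<in> dots n T \<longleftrightarrow> c = root n \<or> c \<in> T \<inter> free_cells n T"
proof -
  note E = fb_tableau_ends[OF T]
  obtain i j where c: "c = (i, j)" by (cases c)
  show ?thesis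
  proof (cases "c = root n \<or> c \<notin> T")
    case True
    then show ?thesis
      using T by (auto simp: dots_def left_arrows_def up_arrows_def fb_tableau_def)
  next
    case False
    then have ij: "(i, j) \<in> T" "(i, j) \<noteq> (1, n)" by (auto simp: c root_def)
    note A = arrow_shapeD(1,2)[OF arrow_shape_tableau[OF T]]
    have "c \<in> left_arrows n T \<longleftrightarrow> j = row_end T i" "c \<in> up_arrows n T \<longleftrightarrow> i = col_top T j"
      using ij(2) fb_tableau_range(1,2)[OF T ij(1)] A
      by (cases "i = 1"; cases "j = n"; simp add: c left_arrows_iff[OF T] up_arrows_iff[OF T])+
    then show ?thesis
      using E(2,4)[OF ij(1)] ij fb_tableau_range(3)[OF T ij(1)] False
      by (auto simp: dots_def free_cells_iff[OF T] c)
  qed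
qed

lemma Row_iff:
  assumes T: "fb_tableau n T"
  shows "(i, j) \<in> Row n T \<longleftrightarrow> (i, j) \<in> board n \<and> j \<le> row_end T i"
proof -
  note A = arrow_shapeD[OF arrow_shape_tableau[OF T]]
  have "(\<exists>d \<in> left_arrows n T. d = (i, j) \<or> strictly_left d (i, j)) \<longleftrightarrow> i \<in> {2..n} \<and> j \<le> row_end T i"
    by (auto simp: left_arrows_iff[OF T] strictly_left_def Bex_def le_less)
  then show ?thesis
    by (cases "i = 1") (auto simp: Row_def root_def strictly_left_def board_def A)
qed

lemma Col_iff:
  assumes T: "fb_tableau n T"
  shows "(i, j) \<in> Col n T \<longleftrightarrow> (i, j) \<in> board n \<and> col_top T j \<le> i"
proof -
  note A = arrow_shapeD[OF arrow_shape_tableau[OF T]]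
  have "(\<exists>d \<in> up_arrows n T. d = (i, j) \<or> strictly_above d (i, j)) \<longleftrightarrow> j \<in> {1..<n} \<and> col_top T j \<le> i"
    by (auto simp: up_arrows_iff[OF T] strictly_above_def Bex_def le_less)
  then show ?thesis
    by (cases "j = n") (auto simp: Col_def root_def strictly_above_def board_def A)
qed

text \<open>Given the first two conditions, a cell is free in both tableaux iff it lies below the
  up-arrow of \<open>S\<close>, the lower of the two, and right of the left-arrow of
  \<open>T\<close>, the one further right. Nonempty free cells are dots, so membership can replace
  \<open>dots\<close>.\<close>

lemma fb_le_iff:
  assumes S: "fb_tableau n S" and T: "fb_tableau n T"
  shows "fb_le n S T \<longleftrightarrow>
    (\<forall>j \<in> {1..n}. col_top T j \<le> col_top S j) \<and> (\<forall>i \<in> {1..n}. row_end T i \<le> row_end S i) \<and>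
    (\<forall>(i, j) \<in> S. col_top S j < i \<and> j < row_end T i \<longrightarrow> (i, j) \<in> T)"
    (is "_ \<longleftrightarrow> ?C \<and> ?R \<and> ?D")
proof -
  have 1: "Col n S \<subseteq> Col n T \<longleftrightarrow> ?C"
  proof
    assume *: "Col n S \<subseteq> Col n T"
    show ?C
    proof
      fix j assume "j \<in> {1..n}"
      then have "(col_top S j, j) \<in> Col n S"
        using fb_tableau_ends(3)[OF S] fb_tableau_range(3)[OF S] by (auto simp: Col_iff[OF S])
      with * show "col_top T j \<le> col_top S j" by (auto simp: Col_iff[OF T])
    qed
  next
    assume *: ?C
    show "Col n S \<subseteq> Col n T"
    proof (rule subrelI)
      fix i j assume "(i, j) \<in> Col n S"
      then show "(i, j) \<in> Col n T"
        using bspec[OF *, of j] by (auto simp: Col_iff[OF T] Col_iff[OF S] board_def)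
    qed
  qed
  have 2: "Row n T \<subseteq> Row n S \<longleftrightarrow> ?R"
  proof
    assume *: "Row n T \<subseteq> Row n S"
    show ?R
    proof
      fix i assume "i \<in> {1..n}"
      then have "(i, row_end T i) \<in> Row n T"
        using fb_tableau_ends(1)[OF T] fb_tableau_range(3)[OF T] by (auto simp: Row_iff[OF T])
      with * show "row_end T i \<le> row_end S i" by (auto simp: Row_iff[OF S])
    qed
  next
    assume *: ?R
    show "Row n T \<subseteq> Row n S"
    proof (rule subrelI)
      fix i j assume "(i, j) \<in> Row n T"
      then show "(i, j) \<in> Row n S"
        using bspec[OF *, of i] by (auto simp: Row_iff[OF T] Row_iff[OF S] board_def)
    qed
  qed
  have 3: "(\<forall>c \<in> free_cells n S \<inter> free_cells n T. c \<in> dots n S \<longrightarrow> c \<in> dots n T) \<longleftrightarrow> ?D"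
    if ?C ?R
  proof -
    have F: "(i, j) \<in> free_cells n S \<inter> free_cells n T \<longleftrightarrow>
        (i, j) \<in> board n \<and> col_top S j < i \<and> j < row_end T i" for i j
      using bspec[OF that(1), of j] bspec[OF that(2), of i]
      by (auto simp: free_cells_iff[OF S] free_cells_iff[OF T] board_def)
    have root: "root n \<notin> free_cells n S \<inter> free_cells n T"
      using arrow_shapeD(2)[OF arrow_shape_tableau[OF S]] F[of 1 n]
      by (auto simp: root_def)
    have "(\<forall>c \<in> free_cells n S \<inter> free_cells n T. c \<in> dots n S \<longrightarrow> c \<in> dots n T) \<longleftrightarrow>
      (\<forall>c \<in> S. c \<in> free_cells n S \<inter> free_cells n T \<longrightarrow> c \<in> T)"
      using root unfolding dots_iff[OF S] dots_iff[OF T] by blast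
    also have "\<dots> \<longleftrightarrow> (\<forall>i j. (i, j) \<in> S \<and> (i, j) \<in> free_cells n S \<inter> free_cells n T \<longrightarrow> (i, j) \<in> T)"
      by (simp only: Ball_def split_paired_All) blast
    also have "\<dots> \<longleftrightarrow> ?D"
      unfolding F using fb_tableau_range(3)[OF S] by blast
    finally show ?thesis .
  qed
  show ?thesis unfolding fb_le_def by (intro conj_cong 1 2 3)
qed

text \<open>All of \<open>T\<close> can serve as its own dot set, because the construction puts in
  the arrows and border cells anyway.\<close>

lemma mk_tableau_self:
  assumes T: "fb_tableau n T"
  shows "mk_tableau n (row_end T) (col_top T) T = T"
proof (intro equalityI subrelI)
  fix i j assume "(i, j) \<in> mk_tableau n (row_end T) (col_top T) T"
  then have *: "(i, j) \<in> board n" "i = col_top T j \<or> j = row_end T i \<or> i = j + 1 \<or> (i, j) \<in> T"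
    by (auto simp: mk_tableau_def)
  have "(j + 1, j) \<in> border n" if "i = j + 1"
    using that *(1) by (auto simp: board_def border_def)
  moreover have "border n \<subseteq> T" using T by (simp add: fb_tableau_def)
  moreover have "(i, row_end T i) \<in> T" "(col_top T j, j) \<in> T"
    using fb_tableau_ends(1,3)[OF T] * by (auto simp: board_def)
  ultimately show "(i, j) \<in> T" using *(2) by blast
next
  fix i j assume "(i, j) \<in> T"
  then show "(i, j) \<in> mk_tableau n (row_end T) (col_top T) T"
    using fb_tableau_ends(2,4)[OF T] fb_tableau_range(3)[OF T] by (auto simp: mk_tableau_def)
qed

end

section \<open>The order\<close>

context fb_board
begin

text \<open>The membership on the right is deliberate: read forwards the equivalence bounds the
  cells of \<open>T\<close>, read backwards it makes arrows and border cells nonempty.\<close>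

lemma mem_tableau_iff:
  assumes "fb_tableau n T"
  shows "(i, j) \<in> T \<longleftrightarrow> (i, j) \<in> board n \<and> col_top T j \<le> i \<and> j \<le> row_end T i \<and>
    (i = col_top T j \<or> j = row_end T i \<or> i = j + 1 \<or> (i, j) \<in> T)"
proof -
  have "(i, j) \<in> T \<longleftrightarrow> (i, j) \<in> mk_tableau n (row_end T) (col_top T) T"
    using mk_tableau_self[OF assms] by simp
  then show ?thesis unfolding mk_tableau_def by auto
qed

lemmas shapeD = arrow_shapeD[OF arrow_shape_tableau]

lemma fb_leE:
  assumes "fb_le n S T" "fb_tableau n S" "fb_tableau n T"
  shows "j \<in> {1..n} \<Longrightarrow> col_top T j \<le> col_top S j"
    and "i \<in> {1..n} \<Longrightarrow> row_end T i \<le> row_end S i"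
    and "(i, j) \<in> S \<Longrightarrow> col_top S j < i \<Longrightarrow> j < row_end T i \<Longrightarrow> (i, j) \<in> T"
  using assms by (auto simp: fb_le_iff)

lemma fb_leI:
  assumes "fb_tableau n S" "fb_tableau n T"
    and "\<And>j. j \<in> {1..n} \<Longrightarrow> col_top T j \<le> col_top S j"
    and "\<And>i. i \<in> {1..n} \<Longrightarrow> row_end T i \<le> row_end S i"
    and "\<And>i j. (i, j) \<in> S \<Longrightarrow> col_top S j < i \<Longrightarrow> j < row_end T i \<Longrightarrow> (i, j) \<in> T"
  shows "fb_le n S T"
  using assms by (auto simp: fb_le_iff)

lemma fb_le_refl: "fb_tableau n T \<Longrightarrow> fb_le n T T"
  by (auto simp: fb_le_iff)

lemma fb_le_trans:
  assumes "fb_le n S T" "fb_le n T U" "fb_tableau n S" "fb_tableau n T" "fb_tableau n U"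
  shows "fb_le n S U"
proof (intro fb_leI assms)
  note ST = fb_leE[OF assms(1,3,4)] and TU = fb_leE[OF assms(2,4,5)]
  show "col_top U j \<le> col_top S j" if "j \<in> {1..n}" for j
    using ST(1)[OF that] TU(1)[OF that] by simp
  show "row_end U i \<le> row_end S i" if "i \<in> {1..n}" for i
    using ST(2)[OF that] TU(2)[OF that] by simp
  show "(i, j) \<in> U" if *: "(i, j) \<in> S" "col_top S j < i" "j < row_end U i" for i j
  proof -
    have "i \<in> {1..n}" "j \<in> {1..n}" using fb_tableau_range[OF assms(3) *(1)] by auto
    \<comment> \<open>The cell is free in \<open>T\<close> too, since
      \<open>col_top T j \<le> col_top S j < i\<close> and
      \<open>j < row_end U i \<le> row_end T i\<close>; so the dot passes from \<open>S\<close> to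
      \<open>T\<close> and on to \<open>U\<close>.\<close>
    then show ?thesis using ST(1,3) TU(2,3) * by (meson le_less_trans less_le_trans)
  qed
qed

lemma fb_le_antisym:
  assumes le: "fb_le n S T" "fb_le n T S" and S: "fb_tableau n S" and T: "fb_tableau n T"
  shows "S = T"
proof -
  have sub: "A \<subseteq> B"
    if le: "fb_le n A B" "fb_le n B A" and A: "fb_tableau n A" and B: "fb_tableau n B" for A B
  proof (rule subrelI)
    fix i j assume *: "(i, j) \<in> A"
    have ij: "i \<in> {1..n}" "j \<in> {1..n}" using fb_tableau_range[OF A *] by auto
    have "col_top A j = col_top B j" "row_end A i = row_end B i"
      using fb_leE(1,2)[OF le(1) A B] fb_leE(1,2)[OF le(2) B A] ij by (simp_all add: order_antisym)
    then show "(i, j) \<in> B"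
      using * fb_leE(3)[OF le(1) A B *] mem_tableau_iff[OF A, of i j] mem_tableau_iff[OF B, of i j]
      by linarith
  qed
  show ?thesis using sub[OF le S T] sub[OF le(2,1) T S] by simp
qed

end

section \<open>Joins and meets\<close>

text \<open>The repaired column top of the join. The inserted row 1 is the value at
  \<open>j = n\<close>, where no row of the board qualifies; for \<open>j < n\<close> it is a
  candidate already, because \<open>l 1 = n\<close>.\<close>

definition join_top :: "(nat \<Rightarrow> nat) \<Rightarrow> (nat \<Rightarrow> nat) \<Rightarrow> nat \<Rightarrow> nat" where
  "join_top l u j = Max (insert 1 {r. r \<le> u j \<and> j < l r})"

text \<open>The dual repair of a row end. The inserted column \<open>n\<close> is the value at
  \<open>i = 1\<close>, as no column top is less than 1; for \<open>i > 1\<close> it is a candidate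
  already, because \<open>u n = 1\<close>.\<close>

definition meet_end :: "nat \<Rightarrow> (nat \<Rightarrow> nat) \<Rightarrow> (nat \<Rightarrow> nat) \<Rightarrow> nat \<Rightarrow> nat" where
  "meet_end n l u i = Min (insert n {c. l i \<le> c \<and> c \<le> n \<and> u c < i})"

lemma join_top:
  shows "1 \<le> join_top l u j"
    and "1 \<le> u j \<Longrightarrow> join_top l u j \<le> u j"
    and "j < l 1 \<Longrightarrow> j < l (join_top l u j)"
    and "r \<le> u j \<Longrightarrow> j < l r \<Longrightarrow> r \<le> join_top l u j"
proof -
  let ?A = "insert 1 {r. r \<le> u j \<and> j < l r}"
  have fin: "finite ?A" by (auto intro: finite_subset[of _ "{..u j}"])
  have *: "Max ?A \<in> ?A" "r \<in> ?A \<Longrightarrow> r \<le> Max ?A" for r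
    by (rule Max_in[OF fin], simp) (rule Max_ge[OF fin])
  show "1 \<le> join_top l u j" unfolding join_top_def by (rule *(2)) simp
  show "join_top l u j \<le> u j" if "1 \<le> u j" using *(1) that unfolding join_top_def by auto
  show "j < l (join_top l u j)" if "j < l 1" using *(1) that unfolding join_top_def by auto
  show "r \<le> join_top l u j" if "r \<le> u j" "j < l r"
    unfolding join_top_def by (rule *(2)) (use that in simp)
qed

lemma meet_end:
  shows "meet_end n l u i \<le> n"
    and "l i \<le> n \<Longrightarrow> l i \<le> meet_end n l u i"
    and "u n < i \<Longrightarrow> u (meet_end n l u i) < i"
    and "l i \<le> c \<Longrightarrow> c \<le> n \<Longrightarrow> u c < i \<Longrightarrow> meet_end n l u i \<le> c"
proof -
  let ?A = "insert n {c. l i \<le> c \<and> c \<le> n \<and> u c < i}"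
  have fin: "finite ?A" by (auto intro: finite_subset[of _ "{..n}"])
  have *: "Min ?A \<in> ?A" "c \<in> ?A \<Longrightarrow> Min ?A \<le> c" for c
    by (rule Min_in[OF fin], simp) (rule Min_le[OF fin])
  show "meet_end n l u i \<le> n" unfolding meet_end_def by (rule *(2)) simp
  show "l i \<le> meet_end n l u i" if "l i \<le> n" using *(1) that unfolding meet_end_def by auto
  show "u (meet_end n l u i) < i" if "u n < i" using *(1) that unfolding meet_end_def by auto
  show "meet_end n l u i \<le> c" if "l i \<le> c" "c \<le> n" "u c < i"
    unfolding meet_end_def by (rule *(2)) (use that in simp)
qed

definition min_end :: "cell set \<Rightarrow> cell set \<Rightarrow> nat \<Rightarrow> nat" where
  "min_end S T i = min (row_end S i) (row_end T i)"

definition max_end :: "cell set \<Rightarrow> cell set \<Rightarrow> nat \<Rightarrow> nat" where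
  "max_end S T i = max (row_end S i) (row_end T i)"

definition min_top :: "cell set \<Rightarrow> cell set \<Rightarrow> nat \<Rightarrow> nat" where
  "min_top S T j = min (col_top S j) (col_top T j)"

definition max_top :: "cell set \<Rightarrow> cell set \<Rightarrow> nat \<Rightarrow> nat" where
  "max_top S T j = max (col_top S j) (col_top T j)"

text \<open>
  An up-arrow of \<open>S\<close> or \<open>T\<close> can be a free cell of the join, where it must not turn into a dot; hence the
  restriction to the cells below the up-arrows.
\<close>

definition fb_join :: "nat \<Rightarrow> cell set \<Rightarrow> cell set \<Rightarrow> cell set" where
  "fb_join n S T = mk_tableau n (min_end S T) (join_top (min_end S T) (min_top S T))
     ({(i, j) \<in> S. col_top S j < i} \<union> {(i, j) \<in> T. col_top T j < i})"

text \<open>Only the row bounds are tested: a free cell of the meet lies below both up-arrows, its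
  column top being the maximum. An empty cell of \<open>S\<close> then blocks a dot only if it is
  right of the left-arrow of \<open>S\<close>, that is, free in \<open>S\<close>; likewise for
  \<open>T\<close>.\<close>

definition fb_meet :: "nat \<Rightarrow> cell set \<Rightarrow> cell set \<Rightarrow> cell set" where
  "fb_meet n S T = mk_tableau n (meet_end n (max_end S T) (max_top S T)) (max_top S T)
     {(i, j). (j < row_end S i \<longrightarrow> (i, j) \<in> S) \<and> (j < row_end T i \<longrightarrow> (i, j) \<in> T)}"

lemma fb_join_commute: "fb_join n S T = fb_join n T S"
  by (simp add: fb_join_def min_end_def[abs_def] min_top_def[abs_def] min.commute Un_commute)

lemma fb_meet_commute: "fb_meet n S T = fb_meet n T S"
  by (simp add: fb_meet_def max_end_def[abs_def] max_top_def[abs_def] max.commute conj_commute)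

context fb_board
begin

context
  fixes S T :: "cell set"
  assumes S: "fb_tableau n S" and T: "fb_tableau n T"
begin

text \<open>The smaller row end comes from \<open>S\<close> or \<open>T\<close>, whose own
  constraint puts a column top above row \<open>i\<close>; lowering tops further keeps this. The
  other constraint holds by the choice of \<open>join_top\<close>.\<close>

lemma join_shape: "arrow_shape n (min_end S T) (join_top (min_end S T) (min_top S T))"
proof -
  note s = shapeD[OF S] and t = shapeD[OF T]
  let ?l = "min_end S T" and ?u = "min_top S T"
  let ?u' = "join_top ?l ?u"
  have l1: "?l 1 = n" by (simp add: min_end_def s t)
  have u: "1 \<le> ?u j" if "j \<in> {1..n}" for j using s(7)[OF that] t(7)[OF that] by (simp add: min_top_def)
  have u': "1 \<le> ?u' j" "?u' j \<le> ?u j" if "j \<in> {1..n}" for j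
    using join_top(1) join_top(2)[of ?u, OF u[OF that]] by auto
  show ?thesis
  proof (rule arrow_shapeI)
    show "?l 1 = n" by fact
    show "?u' n = 1" using u'[of n] n by (simp add: min_top_def s t)
    show "(i, ?l i) \<in> board n" if "i \<in> {1..n}" for i
      using that s(3-5)[OF that] t(3-5)[OF that] by (auto simp: board_def min_end_def)
    show "(?u' j, j) \<in> board n" if "j \<in> {1..n}" for j
      using that s(6-8)[OF that] t(6-8)[OF that] u'[OF that] by (auto simp: board_def min_top_def)
    show "?u' (?l i) < i" if "i \<in> {1..n}" "i \<noteq> 1" for i
    proof -
      have "?l i \<in> {1..n}" using s(4,5)[OF that(1)] t(4,5)[OF that(1)] by (auto simp: min_end_def)
      then have "?u' (?l i) \<le> ?u (?l i)" by (rule u')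
      also have "\<dots> < i" using s(9)[OF that] t(9)[OF that] by (auto simp: min_end_def min_top_def min_def)
      finally show ?thesis .
    qed
    show "j < ?l (?u' j)" if "j \<in> {1..n}" "j \<noteq> n" for j
      using that join_top(3)[of j ?l ?u] l1 by simp
  qed
qed

text \<open>Dually, the larger column top comes from \<open>S\<close> or \<open>T\<close>, whose row
  end lies to its left; enlarging row ends keeps this, and \<open>meet_end\<close> is chosen for the
  other constraint.\<close>

lemma meet_shape: "arrow_shape n (meet_end n (max_end S T) (max_top S T)) (max_top S T)"
proof -
  note s = shapeD[OF S] and t = shapeD[OF T]
  let ?l = "max_end S T" and ?u = "max_top S T"
  let ?l' = "meet_end n ?l ?u"
  have un: "?u n = 1" by (simp add: max_top_def s t)
  have l: "?l i \<le> n" if "i \<in> {1..n}" for i using s(5)[OF that] t(5)[OF that] by (simp add: max_end_def)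
  have l': "?l' i \<le> n" "?l i \<le> ?l' i" if "i \<in> {1..n}" for i
    using meet_end(1) meet_end(2)[of ?l, OF l[OF that]] by auto
  show ?thesis
  proof (rule arrow_shapeI)
    show "?u n = 1" by fact
    show "?l' 1 = n" using l'[of 1] n by (simp add: max_end_def s t)
    show "(i, ?l' i) \<in> board n" if "i \<in> {1..n}" for i
      using that s(3-5)[OF that] t(3-5)[OF that] l'[OF that] by (auto simp: board_def max_end_def)
    show "(?u j, j) \<in> board n" if "j \<in> {1..n}" for j
      using that s(6-8)[OF that] t(6-8)[OF that] by (auto simp: board_def max_top_def)
    show "j < ?l' (?u j)" if "j \<in> {1..n}" "j \<noteq> n" for j
    proof -
      have "j < ?l (?u j)" using s(10)[OF that] t(10)[OF that] by (auto simp: max_end_def max_top_def max_def)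
      also have "?u j \<in> {1..n}" using s(7,8)[OF that(1)] t(7,8)[OF that(1)] by (auto simp: max_top_def)
      then have "?l (?u j) \<le> ?l' (?u j)" by (rule l')
      finally show ?thesis .
    qed
    show "?u (?l' i) < i" if "i \<in> {1..n}" "i \<noteq> 1" for i
      using that meet_end(3)[of ?u n i ?l] un by simp
  qed
qed

lemma fb_tableau_join: "fb_tableau n (fb_join n S T)"
  and row_end_join: "i \<in> {1..n} \<Longrightarrow> row_end (fb_join n S T) i = min_end S T i"
  and col_top_join:
    "j \<in> {1..n} \<Longrightarrow> col_top (fb_join n S T) j = join_top (min_end S T) (min_top S T) j"
  unfolding fb_join_def by (simp_all add: mk_tableau[OF join_shape])

lemma fb_tableau_meet: "fb_tableau n (fb_meet n S T)"
  and row_end_meet: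
    "i \<in> {1..n} \<Longrightarrow> row_end (fb_meet n S T) i = meet_end n (max_end S T) (max_top S T) i"
  and col_top_meet: "j \<in> {1..n} \<Longrightarrow> col_top (fb_meet n S T) j = max_top S T j"
  unfolding fb_meet_def by (simp_all add: mk_tableau[OF meet_shape])

lemma join_top_le: "j \<in> {1..n} \<Longrightarrow> join_top (min_end S T) (min_top S T) j \<le> min_top S T j"
  using shapeD(7)[OF S] shapeD(7)[OF T] by (intro join_top(2)) (simp add: min_top_def)

lemma meet_end_ge: "i \<in> {1..n} \<Longrightarrow> max_end S T i \<le> meet_end n (max_end S T) (max_top S T) i"
  using shapeD(5)[OF S] shapeD(5)[OF T] by (intro meet_end(2)) (simp add: max_end_def)

lemma mem_join_iff:
  assumes "(i, j) \<in> board n" "join_top (min_end S T) (min_top S T) j < i" "j < min_end S T i"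
  shows "(i, j) \<in> fb_join n S T \<longleftrightarrow>
    i = j + 1 \<or> (i, j) \<in> S \<and> col_top S j < i \<or> (i, j) \<in> T \<and> col_top T j < i"
  using assms by (auto simp: fb_join_def mk_tableau_def)

lemma mem_meet_iff:
  assumes "(i, j) \<in> board n" "max_top S T j < i" "j < meet_end n (max_end S T) (max_top S T) i"
  shows "(i, j) \<in> fb_meet n S T \<longleftrightarrow>
    (j < row_end S i \<longrightarrow> (i, j) \<in> S) \<and> (j < row_end T i \<longrightarrow> (i, j) \<in> T)"
proof -
  \<comment> \<open>The border disjunct of the construction is absorbed here: border cells are
    nonempty in both tableaux.\<close>
  have "i = j + 1 \<Longrightarrow> j < row_end S i \<Longrightarrow> (i, j) \<in> S" "i = j + 1 \<Longrightarrow> j < row_end T i \<Longrightarrow> (i, j) \<in> T"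
    using assms(1,2) mem_tableau_iff[OF S, of i j] mem_tableau_iff[OF T, of i j]
    by (auto simp: max_top_def)
  then show ?thesis using assms by (auto simp: fb_meet_def mk_tableau_def)
qed

lemma fb_join_upper: "fb_le n S (fb_join n S T)"
proof (rule fb_leI[OF S fb_tableau_join])
  show "col_top (fb_join n S T) j \<le> col_top S j" if "j \<in> {1..n}" for j
    using join_top_le[OF that] by (simp add: col_top_join[OF that] min_top_def)
  show "row_end (fb_join n S T) i \<le> row_end S i" if "i \<in> {1..n}" for i
    by (simp add: row_end_join[OF that] min_end_def)
  show "(i, j) \<in> fb_join n S T"
    if *: "(i, j) \<in> S" "col_top S j < i" "j < row_end (fb_join n S T) i" for i j
  proof -
    note ij = fb_tableau_range[OF S *(1)]
    have "join_top (min_end S T) (min_top S T) j < i"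
      using join_top_le[OF ij(2)] *(2) by (simp add: min_top_def)
    then show ?thesis using mem_join_iff[OF ij(3)] * by (simp add: row_end_join[OF ij(1)])
  qed
qed

lemma fb_meet_lower: "fb_le n (fb_meet n S T) S"
proof (rule fb_leI[OF fb_tableau_meet S])
  show "col_top S j \<le> col_top (fb_meet n S T) j" if "j \<in> {1..n}" for j
    by (simp add: col_top_meet[OF that] max_top_def)
  show "row_end S i \<le> row_end (fb_meet n S T) i" if "i \<in> {1..n}" for i
    using meet_end_ge[OF that] by (simp add: row_end_meet[OF that] max_end_def)
  show "(i, j) \<in> S"
    if *: "(i, j) \<in> fb_meet n S T" "col_top (fb_meet n S T) j < i" "j < row_end S i" for i j
  proof -
    note ij = fb_tableau_range[OF fb_tableau_meet *(1)]
    have "j < meet_end n (max_end S T) (max_top S T) i"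
      using meet_end_ge[OF ij(1)] *(3) by (simp add: max_end_def)
    then show ?thesis using mem_meet_iff[OF ij(3)] * by (simp add: col_top_meet[OF ij(2)])
  qed
qed

lemma fb_join_least:
  assumes V: "fb_tableau n V" and SV: "fb_le n S V" and TV: "fb_le n T V"
  shows "fb_le n (fb_join n S T) V"
proof (rule fb_leI[OF fb_tableau_join V])
  note sv = fb_leE[OF SV S V] and tv = fb_leE[OF TV T V] and v = shapeD[OF V]
  have l: "row_end V i \<le> min_end S T i" if "i \<in> {1..n}" for i
    using sv(2)[OF that] tv(2)[OF that] by (simp add: min_end_def)
  show "col_top V j \<le> col_top (fb_join n S T) j" if "j \<in> {1..n}" for j
  proof (cases "j = n")
    case True
    then show ?thesis using v(2) join_top(1) unfolding col_top_join[OF that] by simp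
  next
    case False
    \<comment> \<open>This chain makes row \<open>col_top V j\<close> a candidate in the maximum
      defining \<open>join_top\<close>, so \<open>V\<close> has to comply with the repair.\<close>
    have "j < row_end V (col_top V j)" using v(10)[OF that False] .
    also have "\<dots> \<le> min_end S T (col_top V j)" using v(7,8)[OF that] by (intro l) simp
    finally show ?thesis
      using sv(1)[OF that] tv(1)[OF that] unfolding col_top_join[OF that]
      by (intro join_top(4)) (simp add: min_top_def)
  qed
  show "row_end V i \<le> row_end (fb_join n S T) i" if "i \<in> {1..n}" for i
    using l[OF that] by (simp add: row_end_join[OF that])
  show "(i, j) \<in> V"
    if *: "(i, j) \<in> fb_join n S T" "col_top (fb_join n S T) j < i" "j < row_end V i" for i j
  proof -
    note ij = fb_tableau_range[OF fb_tableau_join *(1)]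
    have 1: "join_top (min_end S T) (min_top S T) j < i" using *(2) by (simp add: col_top_join[OF ij(2)])
    have 2: "j < min_end S T i" using l[OF ij(1)] *(3) by simp
    consider "i = j + 1" | "(i, j) \<in> S" "col_top S j < i" | "(i, j) \<in> T" "col_top T j < i"
      using *(1) unfolding mem_join_iff[OF ij(3) 1 2] by blast
    then show ?thesis
    proof cases
      \<comment> \<open>A border cell needs no information from \<open>S\<close> or
        \<open>T\<close>: it lies within the ends of \<open>V\<close>, hence is nonempty
        there.\<close>
      case 1
      then show ?thesis
        using mem_tableau_iff[OF V, of i j] ij(3) v(6)[OF ij(2)] *(3) by auto
    qed (use sv(3) tv(3) *(3) in blast)+
  qed
qed

lemma fb_meet_greatest:
  assumes V: "fb_tableau n V" and SV: "fb_le n V S" and TV: "fb_le n V T"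
  shows "fb_le n V (fb_meet n S T)"
proof (rule fb_leI[OF V fb_tableau_meet])
  note sv = fb_leE[OF SV V S] and tv = fb_leE[OF TV V T] and v = shapeD[OF V]
  have u: "max_top S T j \<le> col_top V j" if "j \<in> {1..n}" for j
    using sv(1)[OF that] tv(1)[OF that] by (simp add: max_top_def)
  show "row_end (fb_meet n S T) i \<le> row_end V i" if "i \<in> {1..n}" for i
  proof (cases "i = 1")
    case True
    then show ?thesis using v(1) meet_end(1) unfolding row_end_meet[OF that] by simp
  next
    case False
    \<comment> \<open>Dually, column \<open>row_end V i\<close> becomes a candidate in the minimum
      defining \<open>meet_end\<close>.\<close>
    have "max_top S T (row_end V i) \<le> col_top V (row_end V i)"
      using v(4,5)[OF that] by (intro u) simp
    also have "\<dots> < i" using v(9)[OF that False] .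
    finally show ?thesis
      using sv(2)[OF that] tv(2)[OF that] v(5)[OF that] unfolding row_end_meet[OF that]
      by (intro meet_end(4)) (simp_all add: max_end_def)
  qed
  show "col_top (fb_meet n S T) j \<le> col_top V j" if "j \<in> {1..n}" for j
    using u[OF that] by (simp add: col_top_meet[OF that])
  show "(i, j) \<in> fb_meet n S T"
    if *: "(i, j) \<in> V" "col_top V j < i" "j < row_end (fb_meet n S T) i" for i j
  proof -
    note ij = fb_tableau_range[OF V *(1)]
    have 1: "max_top S T j < i" using u[OF ij(2)] *(2) by simp
    have 2: "j < meet_end n (max_end S T) (max_top S T) i" using *(3) by (simp add: row_end_meet[OF ij(1)])
    show ?thesis unfolding mem_meet_iff[OF ij(3) 1 2] using sv(3) tv(3) * by blast
  qed
qed

end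

section \<open>Small and binary tableaux are closed under join and meet\<close>

lemma small_iff:
  "small n T \<longleftrightarrow> fb_tableau n T \<and> (\<forall>i j. (i, j) \<in> T \<longrightarrow> col_top T j < i \<longrightarrow> j \<ge> row_end T i)"
proof (cases "fb_tableau n T")
  case T: True
  have "root n \<notin> free_cells n T" using shapeD(2)[OF T] by (auto simp: root_def free_cells_iff[OF T])
  then have "dots n T = {root n} \<longleftrightarrow> (\<forall>c. c \<in> T \<longrightarrow> c \<notin> free_cells n T)"
    unfolding set_eq_iff dots_iff[OF T] Int_iff singleton_iff by metis
  also have "\<dots> \<longleftrightarrow> (\<forall>i j. (i, j) \<in> T \<longrightarrow> col_top T j < i \<longrightarrow> j \<ge> row_end T i)"
    using fb_tableau_range(3)[OF T]
    by (simp only: split_paired_All free_cells_iff[OF T] not_less[symmetric]) blast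
  finally show ?thesis using T by (simp add: small_def)
qed (simp add: small_def)

lemma binary_iff:
  "binary n T \<longleftrightarrow> fb_tableau n T \<and> (\<forall>i j. (i, j) \<in> board n \<longrightarrow> col_top T j < i \<longrightarrow> j \<ge> row_end T i)"
proof (cases "fb_tableau n T")
  case T: True
  have "free_cells n T = {} \<longleftrightarrow> (\<forall>i j. (i, j) \<notin> free_cells n T)" by auto
  also have "\<dots> \<longleftrightarrow> (\<forall>i j. (i, j) \<in> board n \<longrightarrow> col_top T j < i \<longrightarrow> j \<ge> row_end T i)"
    by (simp only: free_cells_iff[OF T] not_less[symmetric]) blast
  finally show ?thesis using T by (simp add: binary_def)
qed (simp add: binary_def)

lemma binary_imp_small: "binary n T \<Longrightarrow> small n T"
  using fb_tableau_range(3) by (auto simp: small_iff binary_iff)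

text \<open>Smallness leaves no dot to inherit, so a nonempty free cell \<open>(i, j)\<close> of the
  join is a border cell. It is nonempty and right of the left-arrow in both \<open>S\<close> and
  \<open>T\<close>, so by smallness it is the column top in both. Then row \<open>i\<close> is a
  candidate in \<open>join_top\<close>, and the cell is not below the column top of the
  join.\<close>

lemma small_join:
  assumes "small n S" "small n T"
  shows "small n (fb_join n S T)"
proof -
  have S: "fb_tableau n S" and T: "fb_tableau n T"
    and s: "\<And>i j. (i, j) \<in> S \<Longrightarrow> col_top S j < i \<Longrightarrow> j \<ge> row_end S i"
    and t: "\<And>i j. (i, j) \<in> T \<Longrightarrow> col_top T j < i \<Longrightarrow> j \<ge> row_end T i"
    using assms by (auto simp: small_iff)
  note J = fb_tableau_join[OF S T]
  have False
    if *: "(i, j) \<in> fb_join n S T" "col_top (fb_join n S T) j < i" "j < row_end (fb_join n S T) i" for i j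
  proof -
    note ij = fb_tableau_range[OF J *(1)]
    have 1: "join_top (min_end S T) (min_top S T) j < i"
      using *(2) by (simp add: col_top_join[OF S T ij(2)])
    have 2: "j < min_end S T i" using *(3) by (simp add: row_end_join[OF S T ij(1)])
    then have l: "j < row_end S i" "j < row_end T i" by (auto simp: min_end_def)
    then have ij1: "i = j + 1"
      using *(1) s t unfolding mem_join_iff[OF S T ij(3) 1 2] by (meson not_less)
    have "(i, j) \<in> S" "(i, j) \<in> T"
      using ij1 mem_tableau_iff[OF S, of i j] mem_tableau_iff[OF T, of i j] ij(3) l
        shapeD(6)[OF S ij(2)] shapeD(6)[OF T ij(2)] by auto
    then have "i \<le> min_top S T j" using s[of i j] t[of i j] l unfolding min_top_def by force
    then show False using join_top(4)[where l = "min_end S T", OF _ 2, of "min_top S T"] 1 by simp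
  qed
  then show ?thesis unfolding small_iff using J not_less by blast
qed

text \<open>At a nonempty free cell \<open>(i, j)\<close> of the meet, smallness forces
  \<open>max_end S T i \<le> j\<close>, as otherwise the cell would be a dot of \<open>S\<close> or
  \<open>T\<close>. Then column \<open>j\<close> is a candidate in \<open>meet_end\<close>, and the
  cell is not right of the row end of the meet.\<close>

lemma small_meet:
  assumes "small n S" "small n T"
  shows "small n (fb_meet n S T)"
proof -
  have S: "fb_tableau n S" and T: "fb_tableau n T"
    and s: "\<And>i j. (i, j) \<in> S \<Longrightarrow> col_top S j < i \<Longrightarrow> j \<ge> row_end S i"
    and t: "\<And>i j. (i, j) \<in> T \<Longrightarrow> col_top T j < i \<Longrightarrow> j \<ge> row_end T i"
    using assms by (auto simp: small_iff)
  note M = fb_tableau_meet[OF S T]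
  have False
    if *: "(i, j) \<in> fb_meet n S T" "col_top (fb_meet n S T) j < i" "j < row_end (fb_meet n S T) i" for i j
  proof -
    note ij = fb_tableau_range[OF M *(1)]
    have 1: "max_top S T j < i" using *(2) by (simp add: col_top_meet[OF S T ij(2)])
    have 2: "j < meet_end n (max_end S T) (max_top S T) i"
      using *(3) by (simp add: row_end_meet[OF S T ij(1)])
    have "max_end S T i \<le> j"
      using *(1) s[of i j] t[of i j] 1 unfolding mem_meet_iff[OF S T ij(3) 1 2]
      by (auto simp: max_end_def max_top_def not_less[symmetric])
    then show False using meet_end(4)[where u = "max_top S T", OF _ _ 1, of "max_end S T" n] 2 ij(2) by simp
  qed
  then show ?thesis unfolding small_iff using M not_less by blast
qed

text \<open>Right of both left-arrows, a cell of row \<open>i\<close> lies below neither up-arrow,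
  so row \<open>i\<close> is a candidate in \<open>join_top\<close>. Hence no cell, empty or not,
  becomes free.\<close>

lemma binary_join:
  assumes "binary n S" "binary n T"
  shows "binary n (fb_join n S T)"
proof -
  have S: "fb_tableau n S" and T: "fb_tableau n T"
    and s: "\<And>i j. (i, j) \<in> board n \<Longrightarrow> col_top S j < i \<Longrightarrow> j \<ge> row_end S i"
    and t: "\<And>i j. (i, j) \<in> board n \<Longrightarrow> col_top T j < i \<Longrightarrow> j \<ge> row_end T i"
    using assms by (auto simp: binary_iff)
  have False
    if *: "(i, j) \<in> board n" "col_top (fb_join n S T) j < i" "j < row_end (fb_join n S T) i" for i j
  proof -
    have ij: "i \<in> {1..n}" "j \<in> {1..n}" using *(1) by (auto simp: board_def)
    have 1: "join_top (min_end S T) (min_top S T) j < i"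
      using *(2) by (simp add: col_top_join[OF S T ij(2)])
    have 2: "j < min_end S T i" using *(3) by (simp add: row_end_join[OF S T ij(1)])
    then have "i \<le> min_top S T j"
      using s[OF *(1)] t[OF *(1)] unfolding min_top_def min_end_def by force
    then show False using join_top(4)[where l = "min_end S T", OF _ 2, of "min_top S T"] 1 by simp
  qed
  then show ?thesis unfolding binary_iff using fb_tableau_join[OF S T] not_less by blast
qed

lemma binary_meet:
  assumes "binary n S" "binary n T"
  shows "binary n (fb_meet n S T)"
proof -
  have S: "fb_tableau n S" and T: "fb_tableau n T"
    and s: "\<And>i j. (i, j) \<in> board n \<Longrightarrow> col_top S j < i \<Longrightarrow> j \<ge> row_end S i"
    and t: "\<And>i j. (i, j) \<in> board n \<Longrightarrow> col_top T j < i \<Longrightarrow> j \<ge> row_end T i"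
    using assms by (auto simp: binary_iff)
  have False
    if *: "(i, j) \<in> board n" "col_top (fb_meet n S T) j < i" "j < row_end (fb_meet n S T) i" for i j
  proof -
    have ij: "i \<in> {1..n}" "j \<in> {1..n}" using *(1) by (auto simp: board_def)
    have 1: "max_top S T j < i" using *(2) by (simp add: col_top_meet[OF S T ij(2)])
    have 2: "j < meet_end n (max_end S T) (max_top S T) i"
      using *(3) by (simp add: row_end_meet[OF S T ij(1)])
    have "max_end S T i \<le> j"
      using s[OF *(1)] t[OF *(1)] 1 by (simp add: max_end_def max_top_def)
    then show False using meet_end(4)[where u = "max_top S T", OF _ _ 1, of "max_end S T" n] 2 ij(2) by simp
  qed
  then show ?thesis unfolding binary_iff using fb_tableau_meet[OF S T] not_less by blast
qed

end

section \<open>Sublattices and bracket vectors\<close>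

text \<open>The operations of the ambient lattice are given only by choice. Uniqueness of least
  upper and greatest lower bounds identifies them with \<open>J\<close> and \<open>M\<close>, so
  closure of \<open>K\<close> under explicit operations suffices.\<close>

lemma sublattice_ofI:
  fixes L :: "'a gorder"
  assumes po: "partial_order L"
    and J: "\<And>x y. x \<in> carrier L \<Longrightarrow> y \<in> carrier L \<Longrightarrow>
      J x y \<in> carrier L \<and> x \<sqsubseteq>\<^bsub>L\<^esub> J x y \<and> y \<sqsubseteq>\<^bsub>L\<^esub> J x y"
    and J_least: "\<And>x y z. x \<in> carrier L \<Longrightarrow> y \<in> carrier L \<Longrightarrow> z \<in> carrier L \<Longrightarrow>
      x \<sqsubseteq>\<^bsub>L\<^esub> z \<Longrightarrow> y \<sqsubseteq>\<^bsub>L\<^esub> z \<Longrightarrow> J x y \<sqsubseteq>\<^bsub>L\<^esub> z"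
    and M: "\<And>x y. x \<in> carrier L \<Longrightarrow> y \<in> carrier L \<Longrightarrow>
      M x y \<in> carrier L \<and> M x y \<sqsubseteq>\<^bsub>L\<^esub> x \<and> M x y \<sqsubseteq>\<^bsub>L\<^esub> y"
    and M_greatest: "\<And>x y z. x \<in> carrier L \<Longrightarrow> y \<in> carrier L \<Longrightarrow> z \<in> carrier L \<Longrightarrow>
      z \<sqsubseteq>\<^bsub>L\<^esub> x \<Longrightarrow> z \<sqsubseteq>\<^bsub>L\<^esub> y \<Longrightarrow> z \<sqsubseteq>\<^bsub>L\<^esub> M x y"
    and K: "K \<subseteq> carrier L" "K \<noteq> {}"
    and J_K: "\<And>x y. x \<in> K \<Longrightarrow> y \<in> K \<Longrightarrow> J x y \<in> K"
    and M_K: "\<And>x y. x \<in> K \<Longrightarrow> y \<in> K \<Longrightarrow> M x y \<in> K"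
  shows "sublattice_of (L\<lparr>carrier := K\<rparr>) L"
proof -
  interpret po: partial_order L by fact
  have lub: "least L (J x y) (Upper L {x, y})" if "x \<in> carrier L" "y \<in> carrier L" for x y
    using J[OF that] J_least[OF that] that
    by (intro least_UpperI) (auto simp: Upper_def)
  have glb: "greatest L (M x y) (Lower L {x, y})" if "x \<in> carrier L" "y \<in> carrier L" for x y
    using M[OF that] M_greatest[OF that] that
    by (intro greatest_LowerI) (auto simp: Lower_def)
  interpret lattice L
    by unfold_locales (rule exI, erule (1) lub, rule exI, erule (1) glb)
  have "x \<squnion>\<^bsub>L\<^esub> y = J x y" if "x \<in> carrier L" "y \<in> carrier L" for x y
    by (rule joinI[OF _ that]) (rule po.least_unique[OF _ lub[OF that]])
  moreover have "x \<sqinter>\<^bsub>L\<^esub> y = M x y" if "x \<in> carrier L" "y \<in> carrier L" for x y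
    by (rule meetI[OF _ that]) (rule po.greatest_unique[OF _ glb[OF that]])
  ultimately show ?thesis
    using K J_K M_K lattice_axioms unfolding sublattice_of_def by (simp add: subset_iff)
qed

section \<open>Binary tableaux and bracket vectors\<close>

definition tableau_to_vector :: "nat \<Rightarrow> cell set \<Rightarrow> nat \<Rightarrow> nat" where
  "tableau_to_vector n T = (\<lambda>k \<in> {1..n - 1}. n - k + 1 - col_top T (n - k))"

text \<open>Inverse to \<open>tableau_to_vector\<close>, whose entry \<open>k\<close> is the number
  of rows by which the up-arrow of column \<open>n - k\<close> lies above the border cell
  \<open>(n - k + 1, n - k)\<close>. Column \<open>n\<close> has no entry; its top is the
  root.\<close>

definition vector_top :: "nat \<Rightarrow> (nat \<Rightarrow> nat) \<Rightarrow> nat \<Rightarrow> nat" where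
  "vector_top n a j = (if j = n then 1 else j + 1 - a (n - j))"

text \<open>For \<open>i > 1\<close> column \<open>n\<close> qualifies, its top being row 1, so the
  minimum exists. For \<open>i = 1\<close> no column qualifies when the tops are at least 1, and the
  value is set by hand.\<close>

definition vector_end :: "nat \<Rightarrow> (nat \<Rightarrow> nat) \<Rightarrow> nat \<Rightarrow> nat" where
  "vector_end n a i = (if i = 1 then n else (LEAST c. i - 1 \<le> c \<and> vector_top n a c < i))"

context fb_board
begin

lemma fb_partial_order:
  assumes "K \<subseteq> {T. fb_tableau n T}"
  shows "partial_order ((esTam n)\<lparr>carrier := K\<rparr>)"
  using assms fb_le_refl fb_le_trans fb_le_antisym
  by unfold_locales (auto simp: esTam_def subset_iff)

text \<open>Meant for two instances: small tableaux among all tableaux, and binary ones among small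
  ones. The order is the same throughout, so one pair of operations serves both.\<close>

lemma fb_sublattice_of:
  assumes L: "L \<subseteq> {T. fb_tableau n T}" and K: "K \<subseteq> L" "K \<noteq> {}"
    and "\<And>S T. S \<in> L \<Longrightarrow> T \<in> L \<Longrightarrow> fb_join n S T \<in> L \<and> fb_meet n S T \<in> L"
    and "\<And>S T. S \<in> K \<Longrightarrow> T \<in> K \<Longrightarrow> fb_join n S T \<in> K \<and> fb_meet n S T \<in> K"
  shows "sublattice_of ((esTam n)\<lparr>carrier := K\<rparr>) ((esTam n)\<lparr>carrier := L\<rparr>)"
proof -
  \<comment> \<open>The bounds are known for the first argument; commutativity carries them over to
    the second.\<close>
  have upper2: "fb_le n T (fb_join n S T)" and lower2: "fb_le n (fb_meet n S T) T"
    if "fb_tableau n S" "fb_tableau n T" for S T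
    using fb_join_upper[OF that(2,1)] fb_meet_lower[OF that(2,1)]
    by (simp_all add: fb_join_commute fb_meet_commute)
  have "sublattice_of ((esTam n)\<lparr>carrier := L\<rparr>\<lparr>carrier := K\<rparr>) ((esTam n)\<lparr>carrier := L\<rparr>)"
    using assms fb_join_upper fb_meet_lower fb_join_least fb_meet_greatest
      upper2 lower2
    by (intro sublattice_ofI[where J = "fb_join n" and M = "fb_meet n"] fb_partial_order)
      (auto simp: esTam_def subset_iff)
  then show ?thesis by simp
qed

text \<open>Column \<open>row_end S i\<close> has its top in \<open>T\<close> above row
  \<open>i\<close>, so the absence of free cells in \<open>T\<close> yields
  \<open>row_end T i \<le> row_end S i\<close>. With no free cells the dot condition is
  vacuous.\<close>

lemma binary_le_iff:
  assumes "binary n S" "binary n T"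
  shows "fb_le n S T \<longleftrightarrow> (\<forall>j \<in> {1..<n}. col_top T j \<le> col_top S j)"
proof
  have S: "fb_tableau n S" and T: "fb_tableau n T"
    and s: "\<And>i j. (i, j) \<in> board n \<Longrightarrow> col_top S j < i \<Longrightarrow> j \<ge> row_end S i"
    and t: "\<And>i j. (i, j) \<in> board n \<Longrightarrow> col_top T j < i \<Longrightarrow> j \<ge> row_end T i"
    using assms by (auto simp: binary_iff)
  show "\<forall>j \<in> {1..<n}. col_top T j \<le> col_top S j" if "fb_le n S T"
    using fb_leE(1)[OF that S T] by auto
  assume *: "\<forall>j \<in> {1..<n}. col_top T j \<le> col_top S j"
  have top: "col_top T j \<le> col_top S j" if "j \<in> {1..n}" for j
    using that * shapeD(2)[OF S] shapeD(2)[OF T] by (cases "j = n") auto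
  have "end": "row_end T i \<le> row_end S i" if i: "i \<in> {1..n}" for i
  proof (cases "i = 1")
    case True
    then show ?thesis using shapeD(1)[OF S] shapeD(1)[OF T] by simp
  next
    case False
    have ij: "(i, row_end S i) \<in> board n"
      using shapeD(3-5)[OF S i] i by (auto simp: board_def)
    have "col_top T (row_end S i) \<le> col_top S (row_end S i)"
      using shapeD(4,5)[OF S i] by (intro top) auto
    also have "\<dots> < i" using shapeD(9)[OF S i False] .
    finally show ?thesis by (rule t[OF ij])
  qed
  show "fb_le n S T"
  proof (intro fb_leI[OF S T] top "end")
    fix i j assume *: "(i, j) \<in> S" "col_top S j < i" "j < row_end T i"
    show "(i, j) \<in> T"
      using s[OF fb_tableau_range(3)[OF S *(1)] *(2)] *(3) "end"[OF fb_tableau_range(1)[OF S *(1)]]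
      by simp
  qed
qed

lemma tableau_to_vector_le_iff:
  assumes "binary n S" "binary n T"
  shows "(\<forall>k \<in> {1..n - 1}. tableau_to_vector n S k \<le> tableau_to_vector n T k) \<longleftrightarrow> fb_le n S T"
proof -
  have S: "fb_tableau n S" and T: "fb_tableau n T" using assms by (auto simp: binary_def)
  have *: "tableau_to_vector n S k \<le> tableau_to_vector n T k \<longleftrightarrow> col_top T (n - k) \<le> col_top S (n - k)"
    if "k \<in> {1..n - 1}" for k
  proof -
    have "n - k \<in> {1..n}" using that by auto
    \<comment> \<open>Column tops are at most \<open>n - k + 1\<close>, so the subtraction is not
      truncated and larger entries mean exactly smaller tops.\<close>
    from shapeD(6)[OF S this] shapeD(6)[OF T this] that show ?thesis
      unfolding tableau_to_vector_def by (simp only: restrict_apply if_True) arith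
  qed
  have im: "{1..<n} = (\<lambda>k. n - k) ` {1..n - 1}"
  proof
    show "{1..<n} \<subseteq> (\<lambda>k. n - k) ` {1..n - 1}"
    proof
      fix j assume "j \<in> {1..<n}"
      then show "j \<in> (\<lambda>k. n - k) ` {1..n - 1}" by (intro image_eqI[of _ _ "n - j"]) auto
    qed
  qed auto
  show ?thesis unfolding binary_le_iff[OF assms] im using * by simp
qed

lemma tableau_to_vector_mem:
  assumes "binary n T"
  shows "tableau_to_vector n T \<in> bracket_vectors n"
proof -
  have T: "fb_tableau n T"
    and t: "\<And>i j. (i, j) \<in> board n \<Longrightarrow> col_top T j < i \<Longrightarrow> j \<ge> row_end T i"
    using assms by (auto simp: binary_iff)
  let ?a = "tableau_to_vector n T"
  have a: "?a k = n - k + 1 - col_top T (n - k)" if "k \<in> {1..n - 1}" for k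
    using that by (simp add: tableau_to_vector_def)
  show ?thesis unfolding bracket_vectors_def
  proof (intro CollectI conjI ballI impI)
    show "?a \<in> extensional {1..n - 1}" by (simp add: tableau_to_vector_def)
    show "?a k \<le> n - k" if k: "k \<in> {1..n - 1}" for k
    proof -
      have "n - k \<in> {1..n}" using k by auto
      then show ?thesis using shapeD(7)[OF T, of "n - k"] by (simp add: a[OF k])
    qed
    show "d + ?a (k + d) \<le> ?a k"
      if k: "k \<in> {1..n - 1}" and d: "d \<in> {1..?a k}" and kd: "k + d \<le> n - 1" for k d
    proof -
      \<comment> \<open>That \<open>d\<close> is at most entry \<open>k\<close> says that column
        \<open>p\<close>, which is \<open>d\<close> columns further right, still reaches row
        \<open>r\<close>. The cell \<open>(r, p)\<close> is right of the row end; not being free, it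
        is not below the top of column \<open>p\<close>. So \<open>r \<le> col_top T p\<close>,
        which is the bracket inequality.\<close>
      define p r where "p = n - (k + d)" and "r = col_top T (n - k)"
      have nk: "n - k \<in> {1..n}" "n - k \<noteq> n" using k by auto
      have "p < n - k" using kd d k by (auto simp: p_def)
      also have "n - k < row_end T r" using shapeD(10)[OF T nk] by (simp add: r_def)
      finally have "p < row_end T r" .
      moreover have "(r, p) \<in> board n"
        using shapeD(7,8)[OF T nk(1)] d k kd by (auto simp: board_def a[OF k] p_def r_def)
      ultimately have "r \<le> col_top T p" using t[of r p] by force
      moreover have "k + d \<in> {1..n - 1}" using k kd by auto
      ultimately show ?thesis using d kd by (auto simp: a[OF k] a p_def r_def)
    qed
  qed
qed

text \<open>The bracket inequality supplies the constraint \<open>j < l (u j)\<close>, and the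
  minimality of the row ends leaves no free cell.\<close>

lemma vector_tableau:
  assumes a: "a \<in> bracket_vectors n"
  shows "\<exists>T. binary n T \<and> tableau_to_vector n T = a"
proof -
  let ?u = "vector_top n a" and ?l = "vector_end n a"
  let ?T = "mk_tableau n ?l ?u {}"
  have ext: "a \<in> extensional {1..n - 1}"
    and a_le: "\<And>k. k \<in> {1..n - 1} \<Longrightarrow> a k \<le> n - k"
    and bracket: "\<And>k d. k \<in> {1..n - 1} \<Longrightarrow> d \<in> {1..a k} \<Longrightarrow> k + d \<le> n - 1 \<Longrightarrow> d + a (k + d) \<le> a k"
    using a by (auto simp: bracket_vectors_def)
  have l: "i - 1 \<le> ?l i" "?u (?l i) < i" "\<And>c. i - 1 \<le> c \<Longrightarrow> ?u c < i \<Longrightarrow> ?l i \<le> c"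
    if "i \<in> {1..n}" "i \<noteq> 1" for i
  proof -
    have "i - 1 \<le> n \<and> ?u n < i" using that by (auto simp: vector_top_def)
    then have "i - 1 \<le> ?l i \<and> ?u (?l i) < i"
      using that(2) LeastI[of "\<lambda>c. i - 1 \<le> c \<and> ?u c < i" n] by (simp add: vector_end_def)
    then show "i - 1 \<le> ?l i" "?u (?l i) < i" by auto
    show "?l i \<le> c" if "i - 1 \<le> c" "?u c < i" for c
      using that \<open>i \<noteq> 1\<close> by (auto simp: vector_end_def intro: Least_le)
  qed
  have un: "?u n = 1" and l1: "?l 1 = n" by (auto simp: vector_top_def vector_end_def)
  have ln: "?l i \<le> n" if "i \<in> {1..n}" for i
    using that l(3)[of i n] un by (cases "i = 1") (auto simp: l1[simplified])
  have u1: "1 \<le> ?u j" if "j \<in> {1..n}" for j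
  proof (cases "j = n")
    case False
    then have "n - j \<in> {1..n - 1}" using that by auto
    from a_le[OF this] that False show ?thesis by (simp add: vector_top_def)
  qed (simp add: vector_top_def)
  have shape: "arrow_shape n ?l ?u"
  proof (rule arrow_shapeI)
    show "(i, ?l i) \<in> board n" if i: "i \<in> {1..n}" for i
      using i l(1)[OF i] ln[OF i] l1 by (cases "i = 1") (auto simp: board_def)
    show "(?u j, j) \<in> board n" if j: "j \<in> {1..n}" for j
      using j u1[OF j] by (auto simp: board_def vector_top_def)
    show "j < ?l (?u j)" if j: "j \<in> {1..n}" "j \<noteq> n" for j
    proof (cases "?u j = 1")
      case True
      then show ?thesis using l1 j by auto
    next
      case False
      define r c where "r = ?u j" and "c = ?l r"
      have r: "r \<in> {1..n}" "r \<noteq> 1" using u1[OF j(1)] j False by (auto simp: r_def vector_top_def)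
      have rc: "r - 1 \<le> c" "?u c < r" using l(1,2)[OF r] by (auto simp: c_def)
      \<comment> \<open>For \<open>c < j\<close> the bracket inequality applies at index
        \<open>n - j\<close> with offset \<open>j - c\<close>, which is admissible because
        \<open>r - 1 \<le> c\<close>. It gives \<open>r \<le> ?u c\<close>, against the choice of
        \<open>c\<close>.\<close>
      have "j < c"
      proof (rule ccontr)
        assume "\<not> j < c"
        moreover have "c \<noteq> j" using rc(2) by (auto simp: r_def)
        ultimately have cj: "c < j" by simp
        have c1: "1 \<le> c" using rc(1) r by auto
        have uj: "r = j + 1 - a (n - j)" using j by (simp add: r_def vector_top_def)
        have uc: "?u c = c + 1 - a (n - c)" using cj j by (simp add: vector_top_def)
        have "n - j \<in> {1..n - 1}" "n - j + (j - c) \<le> n - 1" "n - j + (j - c) = n - c"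
          using j cj c1 by auto
        moreover have "j - c \<in> {1..a (n - j)}" unfolding atLeastAtMost_iff using cj rc(1) uj by linarith
        ultimately have "j - c + a (n - c) \<le> a (n - j)" using bracket by metis
        then show False using rc(2) cj uc uj by linarith
      qed
      then show ?thesis by (simp add: c_def r_def)
    qed
  qed (use un l1 l in auto)
  note T = mk_tableau[OF shape, where D = "{}"]
  have "binary n ?T" unfolding binary_iff
  proof (intro conjI allI impI T)
    fix i j assume *: "(i, j) \<in> board n" "col_top ?T j < i"
    then have ij: "i \<in> {1..n}" "j \<in> {1..n}" "i - 1 \<le> j" by (auto simp: board_def)
    have u: "?u j < i" using *(2) by (simp only: T(3)[OF ij(2)])
    then have "i \<noteq> 1" using u1[OF ij(2)] by auto
    then have "?l i \<le> j" by (rule l(3)[OF ij(1) _ ij(3) u])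
    then show "row_end ?T i \<le> j" by (simp only: T(2)[OF ij(1)])
  qed
  moreover have "tableau_to_vector n ?T = a"
  proof
    fix k
    show "tableau_to_vector n ?T k = a k"
    proof (cases "k \<in> {1..n - 1}")
      case True
      then have nk: "n - k \<in> {1..n}" "n - k \<noteq> n" "n - (n - k) = k" by auto
      show ?thesis
        using True a_le[OF True] nk
        by (simp add: tableau_to_vector_def T(3)[OF nk(1)] vector_top_def)
    next
      case False
      then show ?thesis using ext by (auto simp: tableau_to_vector_def extensional_def)
    qed
  qed
  ultimately show ?thesis by blast
qed

lemma binary_Tamari_iso: "order_isomorphic (binary_poset n) (Tamari n)"
proof -
  let ?f = "tableau_to_vector n"
  have sub: "{T. binary n T} \<subseteq> {T. fb_tableau n T}" by (auto simp: binary_def)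
  \<comment> \<open>Equal vectors compare in both directions, so injectivity follows from
    antisymmetry.\<close>
  have "inj_on ?f {T. binary n T}"
  proof (rule inj_onI)
    fix S T assume *: "S \<in> {T. binary n T}" "T \<in> {T. binary n T}" "?f S = ?f T"
    then have "fb_le n S T" "fb_le n T S"
      using tableau_to_vector_le_iff[of S T] tableau_to_vector_le_iff[of T S] by auto
    then show "S = T" using fb_le_antisym sub *(1,2) by blast
  qed
  moreover have "?f ` {T. binary n T} = bracket_vectors n"
    using tableau_to_vector_mem vector_tableau by fast
  ultimately have "bij_betw ?f (carrier (binary_poset n)) (carrier (Tamari n))"
    by (simp add: bij_betw_def binary_poset_def Tamari_def)
  moreover have "weak_partial_order (binary_poset n)"
    using fb_partial_order[OF sub] unfolding binary_poset_def partial_order_def by blast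
  moreover have "weak_partial_order (Tamari n)"
  proof -
    \<comment> \<open>Comparison sees only the indices in \<open>{1..n - 1}\<close>; extensionality
      makes it antisymmetric.\<close>
    have antisym: "a = b"
      if "a \<in> bracket_vectors n" "b \<in> bracket_vectors n"
        "\<forall>i \<in> {1..n - 1}. a i \<le> b i" "\<forall>i \<in> {1..n - 1}. b i \<le> a i" for a b
    proof (rule extensionalityI)
      show "a \<in> extensional {1..n - 1}" "b \<in> extensional {1..n - 1}"
        using that(1,2) by (simp_all add: bracket_vectors_def)
      show "a i = b i" if "i \<in> {1..n - 1}" for i
        using that \<open>\<forall>i \<in> {1..n - 1}. a i \<le> b i\<close> \<open>\<forall>i \<in> {1..n - 1}. b i \<le> a i\<close>
        by (simp add: order_antisym)
    qed
    have trans: "\<forall>i \<in> {1..n - 1}. a i \<le> c i"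
      if "\<forall>i \<in> {1..n - 1}. a i \<le> b i" "\<forall>i \<in> {1..n - 1}. b i \<le> c i" for a b c :: "nat \<Rightarrow> nat"
      using that order_trans by blast
    show ?thesis
      by unfold_locales
        (simp_all add: Tamari_def del: One_nat_def, rule antisym, assumption+, rule trans, assumption+)
  qed
  ultimately show ?thesis
    unfolding order_isomorphic_def order_emb_def
    using tableau_to_vector_le_iff tableau_to_vector_mem
    by (auto simp: binary_poset_def Tamari_def esTam_def intro!: exI[of _ ?f])
qed

text \<open>Sublattices must be nonempty. The zero vector yields a binary tableau, which is also a
  small one.\<close>

lemma binary_exists: "\<exists>T. binary n T"
  using vector_tableau[of "\<lambda>k \<in> {1..n - 1}. 0"] by (auto simp: bracket_vectors_def)

end

theorem proposition1p2:
  fixes n :: nat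
  assumes "n \<ge> 1"
  shows "sublattice_of (sTam n) (esTam n) \<and>
         sublattice_of (binary_poset n) (sTam n) \<and>
         order_isomorphic (binary_poset n) (Tamari n)"
proof (intro conjI)
  interpret fb_board n by unfold_locales fact
  obtain B where B: "binary n B" using binary_exists ..
  \<comment> \<open>A trivial carrier update brings \<open>esTam n\<close> into the form required by
    \<open>fb_sublattice_of\<close>.\<close>
  have es: "esTam n = (esTam n)\<lparr>carrier := {T. fb_tableau n T}\<rparr>" by (simp add: esTam_def)
  have fb: "fb_tableau n (fb_join n S T) \<and> fb_tableau n (fb_meet n S T)"
    if "fb_tableau n S" "fb_tableau n T" for S T
    using fb_tableau_join[OF that] fb_tableau_meet[OF that] by simp
  have small: "{T. small n T} \<subseteq> {T. fb_tableau n T}" by (auto simp: small_def)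
  have "sublattice_of (sTam n) ((esTam n)\<lparr>carrier := {T. fb_tableau n T}\<rparr>)"
    unfolding sTam_def
    using B binary_imp_small small fb small_join small_meet
    by (intro fb_sublattice_of) auto
  then show "sublattice_of (sTam n) (esTam n)" using es by simp
  show "sublattice_of (binary_poset n) (sTam n)"
    unfolding sTam_def binary_poset_def
    using B binary_imp_small small small_join small_meet binary_join binary_meet
    by (intro fb_sublattice_of) auto
  show "order_isomorphic (binary_poset n) (Tamari n)" by (rule binary_Tamari_iso)
qed

end
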